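(* Let $q$ be a prime power and let $g,n$ be positive integers with $g\mid q^2+q+1$. If $$n\le q+1-\left\lfloor \frac{g}{2}\right\rfloor,\qquad n=ag+r,\qquad 0\le r<g,$$ with $a,r$ integers, then $$G(g,n)\le \frac{q^2+q+1}{g}-\left\lceil \frac{\frac{q^2+q+1}{g}+\frac{g a(a-1)}2+ra}{n}\right\rceil.$$
   Context: A finite set $\mathcal{G}\subset\mathbb{Z}$ is a $g$-Golomb ruler if for every positive integer $d$ the number of pairs $(a,c)\in \mathcal{G}^2$ with $c-a=d$ is at most $g$. $G(g,n)$ denotes the minimum possible diameter (largest element minus smallest element) of a $g$-Golomb ruler with exactly $n$ elements (marks). *)

theory Defs
  imports Complex_Main "HOL-Number_Theory.Prime_Powers"
begin

definition golomb_ruler :: "nat \<Rightarrow> int set \<Rightarrow> bool" where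
  "golomb_ruler g S \<longleftrightarrow>
     finite S \<and> (\<forall>d>0. card {(a, c). a \<in> S \<and> c \<in> S \<and> c - a = d} \<le> g)"

(* Only meaningful for finite nonempty sets. *)
definition diameter :: "int set \<Rightarrow> int" where
  "diameter S = Max S - Min S"

(* For g, n > 0 such rulers exist (e.g. n distinct powers of two), so the minimum is attained;
   the diameter of a finite nonempty set is nonnegative, hence of the form int D. *)
definition min_golomb_diameter :: "nat \<Rightarrow> nat \<Rightarrow> nat" where
  "min_golomb_diameter g n =
     (LEAST D. \<exists>S. golomb_ruler g S \<and> card S = n \<and> diameter S = int D)"

end

theory Submission
  imports Defs "HOL-Computational_Algebra.Polynomial" "HOL-Number_Theory.Cong"
begin

text \<open>Let \<open>v = q\<^sup>2 + q + 1\<close> and \<open>m = v / g\<close>. A Singer difference set is a set of \<open>q + 1\<close> residues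
  modulo \<open>v\<close> whose differences of distinct elements are pairwise distinct. Modulo \<open>m\<close> each nonzero difference is
  attained at most \<open>g\<close> times, and since at most \<open>g - 1\<close> ordered pairs collide, at least
  \<open>q + 1 - \<lfloor>g / 2\<rfloor>\<close> residues survive. Choose \<open>n\<close> of them and cut the circle \<open>\<int> / m\<close> at the largest
  gap \<open>G\<close>; the result is a ruler of diameter \<open>m - G\<close>. The \<open>n\<close> gaps sum to \<open>m\<close> and each length
  occurs at most \<open>g\<close> times, so the \<open>j\<close>-th largest is at most \<open>G - \<lfloor>j / g\<rfloor>\<close>, which gives
  \<open>m + (\<Sum>j<n. \<lfloor>j / g\<rfloor>) \<le> n G\<close>.

  The Singer set consists of the logarithms of \<open>1\<close> and of \<open>x + c\<close> with \<open>c \<in> GF(q)\<close> to the base of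
  a generator \<open>x\<close> of \<open>GF(q\<^sup>3)\<^sup>*\<close>, taken modulo \<open>v\<close>. The field \<open>GF(q\<^sup>3)\<close> is handled as congruence modulo a
  prime ideal above \<open>p\<close>, where \<open>x\<close> is the image of a primitive \<open>(q\<^sup>3 - 1)\<close>-th root of unity.\<close>

subsection \<open>Prime ideals over a rational prime in the integers of a cyclotomic field\<close>

locale ring_ideal =
  fixes M :: "'a :: comm_ring_1 set"
  assumes zero_mem: "0 \<in> M"
    and add_mem: "a \<in> M \<Longrightarrow> b \<in> M \<Longrightarrow> a + b \<in> M"
    and mult_mem: "a \<in> M \<Longrightarrow> r * a \<in> M"
begin

lemma uminus_mem: "a \<in> M \<Longrightarrow> - a \<in> M"
  using mult_mem[of a "-1"] by simp

lemma diff_mem: "a \<in> M \<Longrightarrow> b \<in> M \<Longrightarrow> a - b \<in> M"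
  using add_mem[of a "-b"] uminus_mem[of b] by simp

lemma mult_mem_right: "a \<in> M \<Longrightarrow> a * r \<in> M"
  using mult_mem[of a r] by (simp add: mult.commute)

lemma sum_mem: "(\<And>i. i \<in> A \<Longrightarrow> f i \<in> M) \<Longrightarrow> sum f A \<in> M"
  by (induction A rule: infinite_finite_induct) (auto simp: zero_mem add_mem)

end

locale prime_ring_ideal = ring_ideal +
  assumes one_not_mem: "1 \<notin> M"
    and prime_mem: "a * b \<in> M \<Longrightarrow> a \<in> M \<or> b \<in> M"

text \<open>Zorn's lemma gives an ideal \<open>M\<close> maximal among those that contain
  \<open>J\<close> but not 1. Maximality makes every element outside \<open>M\<close> invertible
  modulo \<open>M\<close>, so \<open>M\<close> is prime.\<close>

lemma exists_prime_ideal_above: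
  fixes J :: "'a :: comm_ring_1 set"
  assumes "ring_ideal J" "1 \<notin> J"
  obtains M where "prime_ring_ideal M" "J \<subseteq> M"
proof -
  define A where "A = {I. ring_ideal I \<and> J \<subseteq> I \<and> 1 \<notin> I}"
  have "\<exists>M\<in>A. \<forall>X\<in>A. M \<subseteq> X \<longrightarrow> X = M"
  proof (rule subset_Zorn_nonempty)
    show "A \<noteq> {}" using assms by (auto simp: A_def)
  next
    fix C assume C: "C \<noteq> {}" "subset.chain A C"
    have idl: "ring_ideal I" "J \<subseteq> I" "1 \<notin> I" if "I \<in> C" for I
      using C(2) that by (auto simp: A_def subset.chain_def)
    have "ring_ideal (\<Union>C)"
    proof
      show "0 \<in> \<Union>C" using C(1) idl(1) ring_ideal.zero_mem by blast
    next
      fix a b assume "a \<in> \<Union>C" "b \<in> \<Union>C"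
      then obtain I K where IK: "I \<in> C" "K \<in> C" "a \<in> I" "b \<in> K" by blast
      then have "I \<subseteq> K \<or> K \<subseteq> I" using C(2) by (auto simp: subset.chain_def)
      then show "a + b \<in> \<Union>C"
        using IK idl(1) ring_ideal.add_mem by (metis UnionI subsetD)
    next
      fix a r assume "a \<in> \<Union>C"
      then show "r * a \<in> \<Union>C" using idl(1) ring_ideal.mult_mem by blast
    qed
    moreover have "J \<subseteq> \<Union>C" using C(1) idl(2) by blast
    ultimately show "\<Union>C \<in> A" using idl(3) by (auto simp: A_def)
  qed
  then obtain M where M: "ring_ideal M" "J \<subseteq> M" "1 \<notin> M"
    and max: "\<And>X. ring_ideal X \<Longrightarrow> J \<subseteq> X \<Longrightarrow> 1 \<notin> X \<Longrightarrow> M \<subseteq> X \<Longrightarrow> X = M"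
    by (auto simp: A_def)
  interpret ring_ideal M by fact
  have comaximal: "\<exists>r. 1 - r * a \<in> M" if "a \<notin> M" for a
  proof -
    \<comment> \<open>The ideal generated by \<open>M\<close> and \<open>a\<close>; it is strictly
      larger than \<open>M\<close>, so it contains 1.\<close>
    define X where "X = {y. \<exists>r. y - r * a \<in> M}"
    have "ring_ideal X"
    proof
      show "0 \<in> X" unfolding X_def using zero_mem by (auto intro!: exI[of _ 0])
    next
      fix y z assume "y \<in> X" "z \<in> X"
      then obtain r s where "y - r * a \<in> M" "z - s * a \<in> M" by (auto simp: X_def)
      from add_mem[OF this] show "y + z \<in> X"
        unfolding X_def by (auto intro!: exI[of _ "r + s"] simp: algebra_simps)
    next
      fix y t assume "y \<in> X"
      then obtain r where "y - r * a \<in> M" by (auto simp: X_def)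
      from mult_mem[OF this, of t] show "t * y \<in> X"
        unfolding X_def by (auto intro!: exI[of _ "t * r"] simp: algebra_simps)
    qed
    moreover have "M \<subseteq> X" by (auto simp: X_def intro!: exI[of _ 0])
    moreover have "a \<in> X" using zero_mem by (auto simp: X_def intro!: exI[of _ 1])
    ultimately have "1 \<in> X" using max[of X] M(2) that by blast
    then show ?thesis by (auto simp: X_def)
  qed
  have "prime_ring_ideal M"
  proof
    show "1 \<notin> M" by fact
    fix a b assume ab: "a * b \<in> M"
    show "a \<in> M \<or> b \<in> M"
    proof (rule ccontr)
      assume "\<not> (a \<in> M \<or> b \<in> M)"
      then obtain r where r: "1 - r * a \<in> M" and b: "b \<notin> M" using comaximal by blast
      \<comment> \<open>Modulo \<open>M\<close>, \<open>r\<close> inverts \<open>a\<close>, so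
        \<open>b\<close> is congruent to \<open>r * (a * b)\<close>, that is, to 0.\<close>
      have "b * (1 - r * a) + r * (a * b) \<in> M"
        by (intro add_mem mult_mem ab r)
      moreover have "b * (1 - r * a) + r * (a * b) = b" by (simp add: algebra_simps)
      ultimately show False using b by simp
    qed
  qed
  then show ?thesis using that M(2) by blast
qed

section \<open>Roots of unity, and the ring Z[zeta] via integer polynomials\<close>

lemma power_minus_1_eq_prod_roots:
  fixes \<zeta> y :: complex
  assumes N: "N > 0" and \<zeta>: "\<zeta> = cis (2 * pi / real N)"
  shows "y ^ N - 1 = (\<Prod>i<N. y - \<zeta> ^ i)"
    and "(\<Prod>i=1..<N. 1 - \<zeta> ^ i) = of_nat N"
proof -
  have inj: "inj_on (\<lambda>i. \<zeta> ^ i) {..<N}" and unity: "(\<zeta> ^ i) ^ N = 1" for i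
    using bij_betw_roots_unity[OF N]
    by (auto simp: \<zeta> bij_betw_def Complex.DeMoivre mult_ac inj_on_def N)
       (metis cis_2pi cis_multiple_2pi Ints_of_nat mult.assoc mult.commute)
  define P where "P = (\<Prod>i<N. [:- (\<zeta> ^ i), 1:])"
  have dP: "degree P = N"
    unfolding P_def by (subst degree_prod_eq_sum_degree) auto
  have lP: "lead_coeff P = 1"
    unfolding P_def by (simp add: lead_coeff_prod)
  have pP: "poly P z = (\<Prod>i<N. z - \<zeta> ^ i)" for z
    unfolding P_def by (simp add: poly_prod)
  \<comment> \<open>Both sides have degree at most \<open>N\<close>, the same coefficient at
    \<open>N\<close>, and agree at \<open>N\<close> distinct points.\<close>
  have PN: "P = monom 1 N - 1"
  proof (rule poly_eqI_degree_lead_coeff[where A = "(\<lambda>i. \<zeta> ^ i) ` {..<N}" and n = N])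
    show "poly P z = poly (monom 1 N - 1) z" if "z \<in> (\<lambda>i. \<zeta> ^ i) ` {..<N}" for z
      using that unity by (auto simp: pP poly_monom intro!: prod_zero)
    show "coeff P N = coeff (monom 1 N - 1) N" using lP dP N by (simp add: coeff_1)
    show "degree (monom (1::complex) N - 1) \<le> N"
      by (intro degree_diff_le) (auto simp: degree_monom_le)
  qed (use inj dP in \<open>auto simp: card_image\<close>)
  show "y ^ N - 1 = (\<Prod>i<N. y - \<zeta> ^ i)"
    using pP[of y] by (simp add: PN poly_monom)
  define Q where "Q = (\<Prod>i=1..<N. [:- (\<zeta> ^ i), 1:])"
  have "{..<N} = insert 0 {1..<N}" using N by auto
  then have "P = [:-1, 1:] * Q" unfolding P_def Q_def by simp
  moreover have "monom 1 N - 1 = [:-1, 1:] * (\<Sum>i<N. monom (1::complex) i)"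
    using power_diff_1_eq[of "monom (1::complex) 1" N]
    by (simp add: monom_power monom_altdef mult.commute minus_pCons one_pCons diff_pCons)
  \<comment> \<open>Cancelling the factor X - 1 leaves 1 + X + ... + X^(N-1), whose value at 1 is
    \<open>N\<close>.\<close>
  ultimately have "Q = (\<Sum>i<N. monom 1 i)" using PN by (metis mult_cancel_left pCons_eq_0_iff zero_neq_one)
  then have "poly Q 1 = of_nat N" by (simp add: poly_sum poly_monom)
  then show "(\<Prod>i=1..<N. 1 - \<zeta> ^ i) = of_nat N" by (simp add: Q_def poly_prod)
qed

text \<open>The coordinate at 1 with respect to a basis of the complex numbers over the rationals
  that contains 1.\<close>

lemma rational_functional:
  obtains L :: "complex \<Rightarrow> rat"
  where "L 1 = 1" "\<And>x y. L (x + y) = L x + L y" "\<And>r x. L (of_rat r * x) = r * L x"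
proof -
  interpret V: vector_space "\<lambda>(r::rat) (x::complex). of_rat r * x"
    by standard (auto simp: algebra_simps of_rat_add of_rat_mult)
  define B where "B = V.extend_basis {1}"
  have ind: "V.independent {1}" using V.dependent_single by simp
  have B: "V.independent B" "1 \<in> B" "V.span B = UNIV"
    using V.independent_extend_basis[OF ind] V.extend_basis_superset[OF ind]
      V.span_extend_basis[OF ind] by (auto simp: B_def)
  show ?thesis
    by (rule that[of "\<lambda>x. V.representation B x 1"])
       (use B in \<open>auto simp: V.representation_basis V.representation_add V.representation_scale\<close>)
qed

lemma common_denominator:
  fixes f :: "nat \<Rightarrow> rat"
  shows "\<exists>D::nat. D > 0 \<and> (\<forall>i<n. of_nat D * f i \<in> \<int>)"
proof (induction n)
  case 0
  then show ?case by (auto intro!: exI[of _ 1])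
next
  case (Suc n)
  then obtain D where D: "D > 0" "\<And>i. i < n \<Longrightarrow> of_nat D * f i \<in> \<int>" by blast
  obtain a b where ab: "quotient_of (f n) = (a, b)" by fastforce
  have b: "b > 0" and fn: "f n = of_int a / of_int b"
    using quotient_of_denom_pos[OF ab] quotient_of_div[OF ab] by auto
  have "of_nat (D * nat b) * f i \<in> \<int>" if "i < Suc n" for i
  proof (cases "i = n")
    case True
    then have "of_nat (D * nat b) * f i = of_int (int D * a)" using b fn by simp
    then show ?thesis by (metis Ints_of_int)
  next
    case False
    then have "of_nat D * f i \<in> \<int>" using D that by auto
    then have "of_nat (nat b) * (of_nat D * f i) \<in> \<int>" by (rule Ints_mult[OF Ints_of_nat])
    then show ?thesis by (simp only: of_nat_mult mult_ac)
  qed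
  then show ?case using D(1) b by (metis mult_pos_pos zero_less_nat_eq)
qed

text \<open>Elements of Z[zeta] are represented by integer polynomials, so that ideals live in a
  ring type. The ideals containing the kernel of this evaluation correspond to the ideals of
  Z[zeta].\<close>

definition eval_int_poly :: "complex \<Rightarrow> int poly \<Rightarrow> complex" where
  "eval_int_poly z f = poly (map_poly of_int f) z"

lemma eval_int_poly_add: "eval_int_poly z (f + g) = eval_int_poly z f + eval_int_poly z g"
proof -
  have "map_poly of_int (f + g) = map_poly of_int f + (map_poly of_int g :: complex poly)"
    by (intro poly_eqI) (simp add: coeff_map_poly)
  then show ?thesis by (simp add: eval_int_poly_def)
qed

lemma eval_int_poly_mult: "eval_int_poly z (f * g) = eval_int_poly z f * eval_int_poly z g"
proof -
  have "map_poly of_int (f * g) = map_poly of_int f * (map_poly of_int g :: complex poly)"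
    by (intro poly_eqI) (simp add: coeff_map_poly coeff_mult)
  then show ?thesis by (simp add: eval_int_poly_def)
qed

lemma eval_int_poly_const: "eval_int_poly z [:c:] = of_int c"
  by (simp add: eval_int_poly_def map_poly_pCons)

lemma eval_int_poly_X: "eval_int_poly z [:0, 1:] = z"
  by (simp add: eval_int_poly_def map_poly_pCons)

lemma eval_int_poly_0: "eval_int_poly z 0 = 0"
  and eval_int_poly_1: "eval_int_poly z 1 = 1"
  and eval_int_poly_of_nat: "eval_int_poly z (of_nat k) = of_nat k"
  using eval_int_poly_const[of z 0] eval_int_poly_const[of z 1] eval_int_poly_const[of z "of_nat k"]
  by (auto simp: one_pCons of_nat_poly)

lemma eval_int_poly_diff: "eval_int_poly z (f - g) = eval_int_poly z f - eval_int_poly z g"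
  using eval_int_poly_add[of z "f - g" g] by simp

lemma eval_int_poly_power: "eval_int_poly z (f ^ k) = eval_int_poly z f ^ k"
  by (induction k) (auto simp: eval_int_poly_1 eval_int_poly_mult)

lemma eval_int_poly_prod: "eval_int_poly z (\<Prod>i\<in>A. h i) = (\<Prod>i\<in>A. eval_int_poly z (h i))"
  by (induction A rule: infinite_finite_induct) (auto simp: eval_int_poly_1 eval_int_poly_mult)

lemmas eval_int_poly_simps = eval_int_poly_add eval_int_poly_mult eval_int_poly_X eval_int_poly_0
  eval_int_poly_1 eval_int_poly_of_nat eval_int_poly_diff eval_int_poly_power eval_int_poly_prod

text \<open>An inverse of \<open>p\<close> in \<open>\<int>[\<zeta>]\<close> would produce all \<open>1 / p ^ k\<close>, but a rational functional has
  bounded denominators on the finitely generated group \<open>\<int>[\<zeta>]\<close>.\<close>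
lemma prime_not_unit_in_cyclotomic:
  fixes \<zeta> :: complex
  assumes p: "(p::nat) \<ge> 2" and N: "N > 0" and \<zeta>: "\<zeta> ^ N = 1"
  shows "of_nat p * eval_int_poly \<zeta> h \<noteq> 1"
proof
  assume eq: "of_nat p * eval_int_poly \<zeta> h = 1"
  obtain L :: "complex \<Rightarrow> rat" where L: "L 1 = 1" "\<And>x y. L (x + y) = L x + L y"
      "\<And>r x. L (of_rat r * x) = r * L x"
    using rational_functional by blast
  have L0: "L 0 = 0" using L(2)[of 0 0] by simp
  have Lsum: "L (\<Sum>i\<in>A. t i) = (\<Sum>i\<in>A. L (t i))" for t and A :: "nat set"
    by (induction A rule: infinite_finite_induct) (auto simp: L0 L)
  obtain D :: nat where D: "D > 0" "\<And>i. i < N \<Longrightarrow> of_nat D * L (\<zeta> ^ i) \<in> \<int>"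
    using common_denominator[of N "\<lambda>i. L (\<zeta> ^ i)"] by blast
  have Dpow: "of_nat D * L (\<zeta> ^ i) \<in> \<int>" for i
  proof -
    have "\<zeta> ^ i = \<zeta> ^ (i mod N)"
      by (subst div_mult_mod_eq[of i N, symmetric], subst power_add)
         (simp add: power_mult mult.commute[of _ N] \<zeta>)
    then show ?thesis using D(2)[of "i mod N"] N by simp
  qed
  have Dint: "of_nat D * L (eval_int_poly \<zeta> f) \<in> \<int>" for f
  proof -
    have "eval_int_poly \<zeta> f = (\<Sum>i\<le>degree (map_poly of_int f :: complex poly).
            of_rat (of_int (coeff f i)) * \<zeta> ^ i)"
      by (simp add: eval_int_poly_def poly_altdef coeff_map_poly)
    then have "of_nat D * L (eval_int_poly \<zeta> f) =
        (\<Sum>i\<le>degree (map_poly of_int f :: complex poly). of_int (coeff f i) * (of_nat D * L (\<zeta> ^ i)))"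
      by (simp only: Lsum L sum_distrib_left mult.left_commute[of "of_nat D"])
    also have "\<dots> \<in> \<int>" by (intro Ints_sum Ints_mult Dpow) auto
    finally show ?thesis .
  qed
  have p0: "p \<noteq> 0" using p by auto
  \<comment> \<open>The exponent \<open>D\<close> suffices: \<open>D / p ^ D\<close> would be an
    integer, although 0 < D < p ^ D.\<close>
  have "eval_int_poly \<zeta> (h ^ D) = of_rat (1 / of_nat p ^ D) * 1"
    using eq p0 by (simp add: eval_int_poly_simps of_rat_divide of_rat_power field_simps
        flip: power_mult_distrib)
  then have "L (eval_int_poly \<zeta> (h ^ D)) = 1 / of_nat p ^ D" by (metis L(1,3) mult.right_neutral)
  then obtain k where k: "of_nat D / of_nat p ^ D = (of_int k :: rat)"
    using Dint[of "h ^ D"] by (auto elim!: Ints_cases)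
  then have "(of_int (int D) :: rat) = of_int (k * int p ^ D)" using p0 by (simp add: field_simps)
  then have "int D = k * int p ^ D" by (simp only: of_int_eq_iff)
  then have "p ^ D dvd D" using D(1) by (metis dvd_triv_right int_dvd_int_iff of_nat_power)
  then have "p ^ D \<le> D" using D(1) by (simp add: dvd_imp_le)
  moreover have "D < p ^ D" using p by (intro power_gt_expt) auto
  ultimately show False by simp
qed

text \<open>\<open>M\<close> is the preimage of a prime ideal of Z[zeta] above \<open>p\<close>, and
  \<open>x\<close> is the indeterminate, which evaluates to zeta. If some \<open>x ^ i\<close> with
  0 < i < N were 1 modulo \<open>M\<close>, the product of all \<open>1 - x ^ i\<close> would put
  \<open>N\<close> into \<open>M\<close>, against coprimality with \<open>p\<close>. For
  \<open>y\<close>, primality picks a factor of the product of all \<open>y - x ^ i\<close>.\<close>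

lemma exists_prime_ideal_roots_of_unity:
  fixes p N :: nat
  assumes p: "prime p" and N: "N > 0" "coprime N p"
  obtains M :: "int poly set" and x
  where "prime_ring_ideal M" "of_nat p \<in> M" "x ^ N - 1 \<in> M"
    "\<And>i. 0 < i \<Longrightarrow> i < N \<Longrightarrow> x ^ i - 1 \<notin> M"
    "\<And>y. y ^ N - 1 \<in> M \<Longrightarrow> \<exists>i<N. y - x ^ i \<in> M"
proof -
  define \<zeta> where "\<zeta> = cis (2 * pi / real N)"
  have \<zeta>N: "\<zeta> ^ N = 1" using N by (simp add: \<zeta>_def Complex.DeMoivre)
  define ev where "ev = eval_int_poly \<zeta>"
  note [simp] = eval_int_poly_simps[of \<zeta>, folded ev_def]
  \<comment> \<open>The preimage of the ideal \<open>p\<close> Z[zeta]. It contains the kernel of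
    \<open>ev\<close> (take h = 0), so complex identities become congruences modulo
    \<open>M\<close>.\<close>
  define J where "J = {f. \<exists>h. ev f = of_nat p * ev h}"
  have J: "ring_ideal J"
  proof
    show "0 \<in> J" by (auto simp: J_def intro!: exI[of _ 0])
  next
    fix a b assume "a \<in> J" "b \<in> J"
    then obtain h k where "ev a = of_nat p * ev h" "ev b = of_nat p * ev k" by (auto simp: J_def)
    then have "ev (a + b) = of_nat p * ev (h + k)" by (simp add: algebra_simps)
    then show "a + b \<in> J" unfolding J_def by blast
  next
    fix a r assume "a \<in> J"
    then obtain h where "ev a = of_nat p * ev h" by (auto simp: J_def)
    then have "ev (r * a) = of_nat p * ev (r * h)" by simp
    then show "r * a \<in> J" unfolding J_def by blast
  qed
  have "1 \<notin> J"
    using prime_not_unit_in_cyclotomic[OF prime_ge_2_nat[OF p] N(1) \<zeta>N]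
    by (auto simp: J_def ev_def[symmetric] dest: sym)
  then obtain M where M: "prime_ring_ideal M" "J \<subseteq> M"
    using exists_prime_ideal_above[OF J] by blast
  interpret prime_ring_ideal M by fact
  have ker: "f \<in> M" if "ev f = 0" for f
    using M(2) that by (force simp: J_def intro: exI[of _ 0])
  have pM: "of_nat p \<in> M" using M(2) by (force simp: J_def intro: exI[of _ 1])
  have prime_prod: "\<exists>i\<in>A. f i \<in> M" if "(\<Prod>i\<in>A. f i) \<in> M" for f and A :: "nat set"
    using that by (induction A rule: infinite_finite_induct) (use one_not_mem prime_mem in auto)
  have NM: "of_nat N \<notin> M"
  proof
    assume NM: "of_nat N \<in> M"
    have "coprime (int N) (int p)" using N(2) by simp
    then obtain u w :: int where "u * int N + w * int p = 1"
      by (metis bezout_int coprime_imp_gcd_eq_1)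
    then have "(of_int (u * int N + w * int p) :: int poly) = 1" by simp
    then have "of_int u * of_nat N + of_int w * of_nat p = (1 :: int poly)" by simp
    then show False using one_not_mem add_mem[OF mult_mem[OF NM] mult_mem[OF pM]] by metis
  qed
  define x :: "int poly" where "x = [:0, 1:]"
  have [simp]: "ev x = \<zeta>" by (simp add: x_def)
  show ?thesis
  proof (rule that[OF M(1) pM, of x])
    show "x ^ N - 1 \<in> M" by (rule ker) (simp add: \<zeta>N)
  next
    fix i assume i: "0 < i" "i < N"
    show "x ^ i - 1 \<notin> M"
    proof
      assume "x ^ i - 1 \<in> M"
      then have "1 - x ^ i \<in> M" using uminus_mem by fastforce
      then have "(\<Prod>i=1..<N. 1 - x ^ i) \<in> M"
        using i by (subst prod.remove[of _ i]) (auto intro: mult_mem_right)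
      moreover have "(\<Prod>i=1..<N. 1 - x ^ i) - of_nat N \<in> M"
        by (rule ker) (use power_minus_1_eq_prod_roots(2)[OF N(1) \<zeta>_def] in simp)
      ultimately show False using NM diff_mem by fastforce
    qed
  next
    fix y assume "y ^ N - 1 \<in> M"
    moreover have "(\<Prod>i<N. y - x ^ i) - (y ^ N - 1) \<in> M"
      by (rule ker) (simp add: power_minus_1_eq_prod_roots(1)[OF N(1) \<zeta>_def])
    ultimately have "(\<Prod>i<N. y - x ^ i) \<in> M" using add_mem by fastforce
    then show "\<exists>i<N. y - x ^ i \<in> M" using prime_prod by blast
  qed
qed

subsection \<open>Singer difference sets\<close>

context ring_ideal
begin

definition ideal_cong :: "'a \<Rightarrow> 'a \<Rightarrow> bool" (infix "\<approx>" 50) where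
  "a \<approx> b \<longleftrightarrow> a - b \<in> M"

lemma ideal_cong_refl [simp]: "a \<approx> a"
  by (simp add: ideal_cong_def zero_mem)

lemma ideal_cong_sym: "a \<approx> b \<Longrightarrow> b \<approx> a"
  using uminus_mem[of "a - b"] by (simp add: ideal_cong_def)

lemma ideal_cong_trans [trans]: "a \<approx> b \<Longrightarrow> b \<approx> c \<Longrightarrow> a \<approx> c"
  using add_mem[of "a - b" "b - c"] by (simp add: ideal_cong_def)

lemma ideal_cong_add: "a \<approx> b \<Longrightarrow> c \<approx> d \<Longrightarrow> a + c \<approx> b + d"
  using add_mem[of "a - b" "c - d"] by (simp add: ideal_cong_def algebra_simps)

lemma ideal_cong_diff: "a \<approx> b \<Longrightarrow> c \<approx> d \<Longrightarrow> a - c \<approx> b - d"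
  using diff_mem[of "a - b" "c - d"] by (simp add: ideal_cong_def algebra_simps)

lemma ideal_cong_mult: "a \<approx> b \<Longrightarrow> c \<approx> d \<Longrightarrow> a * c \<approx> b * d"
  using add_mem[OF mult_mem[of "c - d" a] mult_mem[of "a - b" d]]
  by (simp add: ideal_cong_def algebra_simps)

lemma ideal_cong_power: "a \<approx> b \<Longrightarrow> a ^ k \<approx> b ^ k"
  by (induction k) (auto intro: ideal_cong_mult)

lemma frobenius_prime:
  assumes "prime p" "of_nat p \<in> M"
  shows "(a + b) ^ p \<approx> a ^ p + b ^ p"
proof -
  have p: "p > 0" using assms(1) by (simp add: prime_gt_0_nat)
  have split: "{..p} = insert 0 (insert p {1..<p})" using p by auto
  have "(a + b) ^ p - (a ^ p + b ^ p) = (\<Sum>k=1..<p. of_nat (p choose k) * a ^ k * b ^ (p - k))"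
    unfolding binomial_ring split using p by simp
  also have "\<dots> \<in> M"
  proof (rule sum_mem)
    fix k assume k: "k \<in> {1..<p}"
    then have "p dvd p choose k"
      using assms(1) by (intro dvd_choose_prime) auto
    then obtain c where "p choose k = p * c" by blast
    then have "of_nat (p choose k) * a ^ k * b ^ (p - k) = (of_nat c * a ^ k * b ^ (p - k)) * of_nat p"
      by simp
    then show "of_nat (p choose k) * a ^ k * b ^ (p - k) \<in> M"
      using mult_mem[OF assms(2)] by metis
  qed
  finally show ?thesis by (simp add: ideal_cong_def)
qed

lemma frobenius:
  assumes "prime p" "of_nat p \<in> M"
  shows "(a + b) ^ (p ^ k) \<approx> a ^ (p ^ k) + b ^ (p ^ k)"
proof (induction k)
  case (Suc k)
  have "(a + b) ^ (p ^ Suc k) = ((a + b) ^ (p ^ k)) ^ p" by (simp add: mult.commute flip: power_mult)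
  also have "\<dots> \<approx> (a ^ (p ^ k) + b ^ (p ^ k)) ^ p" by (rule ideal_cong_power[OF Suc])
  also have "\<dots> \<approx> (a ^ (p ^ k)) ^ p + (b ^ (p ^ k)) ^ p" by (rule frobenius_prime[OF assms])
  also have "\<dots> = a ^ (p ^ Suc k) + b ^ (p ^ Suc k)" by (simp add: mult.commute flip: power_mult)
  finally show ?case .
qed simp

end

text \<open>Modulo \<open>M\<close>, 0 and the powers of \<open>x\<close> form a copy of GF(q^3);
  congruence plays the role of equality in that field.\<close>

locale singer_field = prime_ring_ideal M for M :: "'a::comm_ring_1 set" +
  fixes p e q v N :: nat and x :: 'a
  assumes p: "prime p" and e: "e > 0" and q: "q = p ^ e" and pM: "of_nat p \<in> M"
    and v: "v = q\<^sup>2 + q + 1" and N: "N = q ^ 3 - 1"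
    and xN: "x ^ N \<approx> 1"
    and order: "0 < i \<Longrightarrow> i < N \<Longrightarrow> \<not> x ^ i \<approx> 1"
    and roots: "y ^ N \<approx> 1 \<Longrightarrow> \<exists>i<N. y \<approx> x ^ i"
begin

lemma q2: "q \<ge> 2"
  using p e unfolding q by (metis prime_ge_2_nat self_le_power dual_order.trans One_nat_def Suc_leI
      prime_gt_0_nat)

lemma N_eq: "N = (q - 1) * v"
proof -
  obtain t where "q = Suc t" using q2 by (cases q) auto
  then show ?thesis unfolding N v by (simp add: power2_eq_square power3_eq_cube algebra_simps)
qed

lemma N_eq_q3: "Suc N = q ^ 3"
  unfolding N using q2 by simp

lemma N_bounds: "v > 0" "N > 0" "q\<^sup>2 < N + 1"
proof -
  show "v > 0" by (simp add: v)
  have "q\<^sup>2 < v" by (simp add: v)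
  moreover have "v \<le> N" using q2 unfolding N_eq by auto
  moreover have "q \<le> q\<^sup>2" using q2 by (simp add: power2_eq_square)
  ultimately show "N > 0" "q\<^sup>2 < N + 1" by auto
qed

lemma prime_ideal_cong: "a * b \<approx> 0 \<Longrightarrow> a \<approx> 0 \<or> b \<approx> 0"
  using prime_mem by (simp add: ideal_cong_def)

lemma one_not_ideal_cong: "\<not> 1 \<approx> 0"
  using one_not_mem by (simp add: ideal_cong_def)

lemma x_power_not_ideal_cong: "\<not> x ^ i \<approx> 0"
proof (induction i)
  case 0
  then show ?case using one_not_ideal_cong by simp
next
  case (Suc i)
  have "\<not> x \<approx> 0"
  proof
    assume "x \<approx> 0"
    then have "x ^ N \<approx> 0" using ideal_cong_power[of x 0 N] N_bounds by (simp add: power_0_left)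
    then show False using xN one_not_ideal_cong ideal_cong_sym ideal_cong_trans by blast
  qed
  then show ?case using Suc prime_ideal_cong[of x "x ^ i"] by auto
qed

lemma x_power_inj_aux:
  assumes "i < j" "j < N + i" shows "\<not> x ^ i \<approx> x ^ j"
proof
  assume "x ^ i \<approx> x ^ j"
  then have "x ^ i * (x ^ (j - i) - 1) \<in> M"
    using assms ideal_cong_sym[of "x ^ i" "x ^ j"] by (simp add: ideal_cong_def algebra_simps flip: power_add)
  then have "x ^ (j - i) \<approx> 1" using prime_mem x_power_not_ideal_cong[of i] by (auto simp: ideal_cong_def)
  then show False using order[of "j - i"] assms by auto
qed

lemma x_power_inj: "i < N \<Longrightarrow> j < N \<Longrightarrow> x ^ i \<approx> x ^ j \<Longrightarrow> i = j"
  using x_power_inj_aux[of i j] x_power_inj_aux[of j i] ideal_cong_sym by (metis linorder_neqE_nat trans_less_add1)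

text \<open>The full preimage of GF(q), the fixed field of the \<open>q\<close>-th power map, hence
  a union of residue classes. \<open>C\<close> below consists of \<open>q\<close> pairwise
  incongruent elements of it.\<close>

definition F :: "'a set" where "F = {y. y ^ q \<approx> y}"

lemma q_frobenius: "(a + b) ^ q \<approx> a ^ q + b ^ q"
  unfolding q by (rule frobenius[OF p pM])

lemma F_power: "y \<in> F \<Longrightarrow> y ^ (q ^ k) \<approx> y"
proof (induction k)
  case (Suc k)
  have "y ^ (q ^ Suc k) = (y ^ (q ^ k)) ^ q" by (simp add: mult.commute flip: power_mult)
  also have "\<dots> \<approx> y ^ q" using Suc by (intro ideal_cong_power) auto
  also have "\<dots> \<approx> y" using Suc by (simp add: F_def)
  finally show ?case .
qed simp

lemma F_0: "0 \<in> F" and F_1: "1 \<in> F"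
  using q2 by (auto simp: F_def power_0_left)

lemma F_add: "a \<in> F \<Longrightarrow> b \<in> F \<Longrightarrow> a + b \<in> F"
  unfolding F_def using ideal_cong_trans[OF q_frobenius ideal_cong_add] by blast

lemma F_mult: "a \<in> F \<Longrightarrow> b \<in> F \<Longrightarrow> a * b \<in> F"
  unfolding F_def by (auto simp: power_mult_distrib intro: ideal_cong_mult)

lemma F_diff:
  assumes "a \<in> F" "b \<in> F" shows "a - b \<in> F"
proof -
  have "a ^ q = ((a - b) + b) ^ q" by simp
  also have "\<dots> \<approx> (a - b) ^ q + b ^ q" by (rule q_frobenius)
  finally have "a ^ q - b ^ q \<approx> (a - b) ^ q"
    using ideal_cong_diff[of "a ^ q" "(a - b) ^ q + b ^ q" "b ^ q" "b ^ q"] by simp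
  then have "(a - b) ^ q \<approx> a ^ q - b ^ q" by (rule ideal_cong_sym)
  also have "\<dots> \<approx> a - b" using assms by (intro ideal_cong_diff) (auto simp: F_def)
  finally show ?thesis by (simp add: F_def)
qed

text \<open>Because \<open>N = (q - 1) * v\<close>, the \<open>q\<close>-th power only multiplies
  \<open>x ^ (v * j)\<close> by a power of \<open>x ^ N\<close>. Thus changing a logarithm by a
  multiple of \<open>v\<close> amounts to a factor from \<open>F\<close>.\<close>

lemma F_x_power: "x ^ (v * j) \<in> F"
proof -
  have "(x ^ (v * j)) ^ q = x ^ (v * j * q)" by (simp add: power_mult)
  also have "v * j * q = N * j + v * j"
    using q2 unfolding N_eq by (cases q) (auto simp: algebra_simps)
  also have "x ^ (N * j + v * j) = (x ^ N) ^ j * x ^ (v * j)" by (simp add: power_add power_mult)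
  also have "\<dots> \<approx> 1 ^ j * x ^ (v * j)" by (intro ideal_cong_mult ideal_cong_power xN) simp
  finally show ?thesis by (simp add: F_def)
qed

text \<open>A quadratic over \<open>F\<close> vanishing at \<open>x\<close> also vanishes at the conjugates \<open>x ^ q\<close> and
  \<open>x ^ (q ^ 2)\<close>, which are distinct.\<close>
lemma quadratic_independent:
  assumes F: "A \<in> F" "B \<in> F" "C \<in> F" and eq: "A * x\<^sup>2 + B * x + C \<approx> 0"
  shows "A \<approx> 0 \<and> B \<approx> 0 \<and> C \<approx> 0"
proof -
  have conj: "A * (y ^ q)\<^sup>2 + B * y ^ q + C \<approx> 0" if "A * y\<^sup>2 + B * y + C \<approx> 0" for y
  proof -
    have "A * (y ^ q)\<^sup>2 + B * y ^ q + C \<approx> A ^ q * (y ^ q)\<^sup>2 + B ^ q * y ^ q + C ^ q"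
      using F by (intro ideal_cong_add ideal_cong_mult ideal_cong_sym[of "A ^ q"] ideal_cong_sym[of "B ^ q"] ideal_cong_sym[of "C ^ q"])
        (auto simp: F_def)
    also have "\<dots> = (A * y\<^sup>2) ^ q + (B * y) ^ q + C ^ q"
      by (simp add: power_mult_distrib flip: power_mult) (simp add: mult.commute)
    also have "\<dots> \<approx> (A * y\<^sup>2 + B * y) ^ q + C ^ q"
      by (intro ideal_cong_add ideal_cong_sym[OF q_frobenius]) simp
    also have "\<dots> \<approx> (A * y\<^sup>2 + B * y + C) ^ q" by (rule ideal_cong_sym[OF q_frobenius])
    also have "\<dots> \<approx> 0 ^ q" by (rule ideal_cong_power[OF that])
    also have "\<dots> = 0" using q2 by (simp add: power_0_left)
    finally show ?thesis .
  qed
  define y z where "y = x ^ q" and "z = x ^ q\<^sup>2"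
  have z: "z = y ^ q" by (simp add: y_def z_def power2_eq_square power_mult)
  have ey: "A * y\<^sup>2 + B * y + C \<approx> 0" using conj[OF eq] by (simp add: y_def)
  have ez: "A * z\<^sup>2 + B * z + C \<approx> 0" using conj[OF ey] by (simp add: z)
  have "q < q\<^sup>2" using q2 by (simp add: power2_eq_square)
  then have ne: "\<not> x \<approx> y" "\<not> x \<approx> z" "\<not> y \<approx> z"
    using x_power_inj_aux[of 1 q] x_power_inj_aux[of 1 "q\<^sup>2"] x_power_inj_aux[of q "q\<^sup>2"] q2 N_bounds
    by (auto simp: y_def z_def)
  \<comment> \<open>Subtracting the equations at \<open>x\<close> and \<open>w\<close> and
    cancelling \<open>x - w\<close> gives the first divided difference; a second difference, between
    \<open>w = y\<close> and \<open>w = z\<close>, isolates \<open>A\<close>.\<close>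
  have lin: "A * (x + w) + B \<approx> 0" if "A * w\<^sup>2 + B * w + C \<approx> 0" "\<not> x \<approx> w" for w
  proof -
    have "(x - w) * (A * (x + w) + B) \<approx> 0"
      using ideal_cong_diff[OF eq that(1)] by (simp add: algebra_simps power2_eq_square)
    then show ?thesis using prime_ideal_cong[of "x - w"] that(2) by (auto simp: ideal_cong_def)
  qed
  have "(y - z) * A \<approx> 0"
    using ideal_cong_diff[OF lin[OF ey ne(1)] lin[OF ez ne(2)]] by (simp add: algebra_simps)
  then have A: "A \<approx> 0" using prime_ideal_cong ne(3) by (auto simp: ideal_cong_def)
  then have B: "B \<approx> 0"
    using ideal_cong_diff[OF lin[OF ey ne(1)] ideal_cong_mult[OF A ideal_cong_refl[of "x + y"]]] by simp
  have "A * x\<^sup>2 + B * x \<approx> 0 * x\<^sup>2 + 0 * x"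
    by (intro ideal_cong_add ideal_cong_mult A B) auto
  then have "C \<approx> 0" using ideal_cong_diff[OF eq] by fastforce
  then show ?thesis using A B by simp
qed

section \<open>Normalised points of the projective line and their logarithms\<close>

definition C :: "'a set" where "C = insert 0 ((\<lambda>j. x ^ (v * j)) ` {..<q - 1})"

lemma C_F: "C \<subseteq> F"
  using F_0 F_x_power by (auto simp: C_def)

lemma vj_less: "j < q - 1 \<Longrightarrow> v * j < N"
  unfolding N_eq using N_bounds(1) by (simp add: mult.commute)

lemma C_inj: "a \<in> C \<Longrightarrow> b \<in> C \<Longrightarrow> a \<approx> b \<Longrightarrow> a = b"
  unfolding C_def using x_power_not_ideal_cong ideal_cong_sym vj_less
  by (auto dest!: x_power_inj[rotated 2] ideal_cong_sym[of 0])

lemma card_C: "card C = q" "finite C"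
proof -
  have "inj_on (\<lambda>j. x ^ (v * j)) {..<q - 1}"
  proof (rule inj_onI)
    fix i j assume "i \<in> {..<q - 1}" "j \<in> {..<q - 1}" "x ^ (v * i) = x ^ (v * j)"
    then have "v * i = v * j" using vj_less x_power_inj[of "v * i" "v * j"] by simp
    then show "i = j" using N_bounds(1) by simp
  qed
  then have "card ((\<lambda>j. x ^ (v * j)) ` {..<q - 1}) = q - 1" by (simp add: card_image)
  moreover have "0 \<notin> (\<lambda>j. x ^ (v * j)) ` {..<q - 1}"
    using x_power_not_ideal_cong by (metis (no_types, lifting) ideal_cong_refl imageE)
  ultimately show "card C = q" using q2 unfolding C_def by (subst card_insert_disjoint) auto
  show "finite C" by (simp add: C_def)
qed

text \<open>The pair \<open>(e, c)\<close> stands for \<open>e x + c\<close>; these pairs are the points of the projective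
  line over \<open>F\<close>, normalised.\<close>
definition P :: "('a \<times> 'a) set" where "P = insert (0, 1) (Pair 1 ` C)"

lemma card_P: "card P = q + 1" "finite P"
proof -
  have "card (Pair (1::'a) ` C) = q" using card_C by (simp add: card_image inj_on_def)
  moreover have "(0, 1) \<notin> Pair (1::'a) ` C" by auto
  ultimately show "card P = q + 1" "finite P" using card_C by (auto simp: P_def)
qed

lemma P_F: "w \<in> P \<Longrightarrow> fst w \<in> F \<and> snd w \<in> F"
  using C_F F_0 F_1 by (auto simp: P_def)

text \<open>A vanishing determinant means proportional coordinates, and normalisation leaves one
  representative per point.\<close>

lemma P_parallel:
  assumes "w \<in> P" "w' \<in> P" "fst w' * snd w \<approx> snd w' * fst w"
  shows "w = w'"
  using assms C_inj one_not_ideal_cong ideal_cong_sym by (auto simp: P_def dest: ideal_cong_sym)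

definition point :: "'a \<times> 'a \<Rightarrow> 'a" where "point w = fst w * x + snd w"

text \<open>The \<open>q ^ 3\<close>-th power map fixes both \<open>x\<close> and \<open>c\<close>,
  hence \<open>x + c\<close>. This is nonzero by linear independence of 1 and \<open>x\<close> over
  \<open>F\<close>, so it is an \<open>N\<close>-th root of unity and therefore a power of
  \<open>x\<close>.\<close>

lemma exists_log:
  assumes "w \<in> P" shows "\<exists>l. point w \<approx> x ^ l"
proof (cases "w = (0, 1)")
  case True
  then show ?thesis by (intro exI[of _ 0]) (simp add: point_def)
next
  case False
  then obtain c where w: "w = (1, c)" "c \<in> C" using assms by (auto simp: P_def)
  then have cF: "c \<in> F" using C_F by auto
  have q3: "q ^ 3 = p ^ (e * 3)" by (simp add: q power_mult)
  have x3: "x ^ (q ^ 3) \<approx> x"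
    using ideal_cong_mult[OF xN ideal_cong_refl[of x]] by (simp add: mult.commute flip: N_eq_q3)
  have "(x + c) ^ (q ^ 3) \<approx> x ^ (q ^ 3) + c ^ (q ^ 3)"
    unfolding q3 by (rule frobenius[OF p pM])
  also have "\<dots> \<approx> x + c" by (intro ideal_cong_add F_power cF x3)
  finally have "(x + c) * (x + c) ^ N - (x + c) \<in> M" by (simp add: ideal_cong_def flip: N_eq_q3)
  then have "(x + c) * ((x + c) ^ N - 1) \<in> M" by (simp add: algebra_simps)
  moreover have "\<not> x + c \<approx> 0"
    using quadratic_independent[of 0 1 c] F_0 F_1 cF one_not_ideal_cong by auto
  ultimately have "(x + c) ^ N \<approx> 1" using prime_mem by (auto simp: ideal_cong_def)
  then show ?thesis using roots by (auto simp: w point_def)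
qed

text \<open>The quadratic forms \<open>\<kappa> * w1 * w4\<close> and \<open>\<mu> * w2 * w3\<close> agree coefficientwise since \<open>x\<close> has
  degree 3 over \<open>F\<close>; now evaluate both at the zero of \<open>w1\<close>.\<close>
lemma unique_factorization:
  assumes P: "w1 \<in> P" "w2 \<in> P" "w3 \<in> P" "w4 \<in> P" and F: "\<kappa> \<in> F" "\<mu> \<in> F" and \<mu>: "\<not> \<mu> \<approx> 0"
    and eq: "\<kappa> * (point w1 * point w4) \<approx> \<mu> * (point w2 * point w3)"
  shows "w1 = w2 \<or> w1 = w3"
proof -
  obtain e1 c1 e2 c2 e3 c3 e4 c4 where
    w: "w1 = (e1, c1)" "w2 = (e2, c2)" "w3 = (e3, c3)" "w4 = (e4, c4)"
    by (metis surj_pair)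
  define X Y Z where "X = \<kappa> * (e1 * e4) - \<mu> * (e2 * e3)"
    and "Y = \<kappa> * (e1 * c4 + e4 * c1) - \<mu> * (e2 * c3 + e3 * c2)"
    and "Z = \<kappa> * (c1 * c4) - \<mu> * (c2 * c3)"
  have "X * x\<^sup>2 + Y * x + Z = \<kappa> * (point w1 * point w4) - \<mu> * (point w2 * point w3)"
    by (simp add: X_def Y_def Z_def w point_def algebra_simps power2_eq_square)
  then have "X * x\<^sup>2 + Y * x + Z \<approx> 0" using eq by (simp add: ideal_cong_def)
  moreover have "X \<in> F" "Y \<in> F" "Z \<in> F"
    using P_F[OF P(1)] P_F[OF P(2)] P_F[OF P(3)] P_F[OF P(4)] F
    unfolding X_def Y_def Z_def w by (auto intro!: F_add F_mult F_diff)
  ultimately have XYZ: "X \<approx> 0" "Y \<approx> 0" "Z \<approx> 0" using quadratic_independent by blast+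
  \<comment> \<open>Homogeneous evaluation at (-c1 : e1), the zero of \<open>e1 * x + c1\<close>;
    this form also covers \<open>e1 = 0\<close>. The \<kappa>-terms cancel.\<close>
  have "X * c1\<^sup>2 - Y * (c1 * e1) + Z * e1\<^sup>2 \<approx> 0 * c1\<^sup>2 - 0 * (c1 * e1) + 0 * e1\<^sup>2"
    by (intro ideal_cong_add ideal_cong_diff ideal_cong_mult XYZ) auto
  moreover have "X * c1\<^sup>2 - Y * (c1 * e1) + Z * e1\<^sup>2
      = - (\<mu> * ((e2 * c1 - c2 * e1) * (e3 * c1 - c3 * e1)))"
    by (simp add: X_def Y_def Z_def algebra_simps power2_eq_square)
  ultimately have "\<mu> * ((e2 * c1 - c2 * e1) * (e3 * c1 - c3 * e1)) \<approx> 0"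
    using uminus_mem by (fastforce simp: ideal_cong_def)
  then have "e2 * c1 - c2 * e1 \<approx> 0 \<or> e3 * c1 - c3 * e1 \<approx> 0"
    using \<mu> prime_ideal_cong by blast
  then show ?thesis
    using P_parallel[OF P(1,2)] P_parallel[OF P(1,3)] by (auto simp: w ideal_cong_def)
qed

definition log_point :: "'a \<times> 'a \<Rightarrow> nat" where "log_point w = (SOME l. point w \<approx> x ^ l)"

lemma log_point: "w \<in> P \<Longrightarrow> point w \<approx> x ^ log_point w"
  unfolding log_point_def using exists_log by (rule someI_ex)

text \<open>Exponentiation turns the congruence modulo \<open>v\<close> into equality of two
  products up to factors from \<open>F\<close>, and \<open>unique_factorization\<close>
  applies.\<close>

lemma log_point_sidon_sums:
  assumes P: "w1 \<in> P" "w2 \<in> P" "w3 \<in> P" "w4 \<in> P"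
    and eq: "[log_point w1 + log_point w4 = log_point w2 + log_point w3] (mod v)"
  shows "w1 = w2 \<or> w1 = w3"
proof -
  obtain s t where "v * s + (log_point w1 + log_point w4) = v * t + (log_point w2 + log_point w3)"
    using eq unfolding cong_iff_lin_nat by (metis add.commute mult.commute)
  then have "x ^ (v * s) * (x ^ log_point w1 * x ^ log_point w4) = x ^ (v * t) * (x ^ log_point w2 * x ^ log_point w3)"
    by (simp flip: power_add)
  moreover have "x ^ (v * s) * (point w1 * point w4) \<approx> x ^ (v * s) * (x ^ log_point w1 * x ^ log_point w4)"
    "x ^ (v * t) * (x ^ log_point w2 * x ^ log_point w3) \<approx> x ^ (v * t) * (point w2 * point w3)"
    by (intro ideal_cong_mult ideal_cong_refl log_point ideal_cong_sym[OF log_point] P)+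
  ultimately have "x ^ (v * s) * (point w1 * point w4) \<approx> x ^ (v * t) * (point w2 * point w3)"
    by (metis ideal_cong_trans)
  then show ?thesis
    using unique_factorization[OF P F_x_power F_x_power x_power_not_ideal_cong] by blast
qed

lemma log_point_sidon:
  assumes P: "w1 \<in> P" "w2 \<in> P" "w3 \<in> P" "w4 \<in> P" and ne: "w1 \<noteq> w2"
    and eq: "[int (log_point w1) - int (log_point w2) = int (log_point w3) - int (log_point w4)] (mod int v)"
  shows "w1 = w3 \<and> w2 = w4"
proof -
  have "[int (log_point w1 + log_point w4) = int (log_point w3 + log_point w2)] (mod int v)"
    using eq by (simp add: cong_iff_dvd_diff algebra_simps)
  then have "[log_point w1 + log_point w4 = log_point w3 + log_point w2] (mod v)" by (simp only: cong_int_iff)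
  then have "w1 = w3 \<or> w1 = w2" "w2 = w1 \<or> w2 = w4"
    using log_point_sidon_sums[OF P(1,3,2,4)] log_point_sidon_sums[OF P(2,1,4,3)]
    by (auto simp: cong_sym_eq add.commute)
  then show ?thesis using ne by auto
qed

lemma log_point_inj: "inj_on (\<lambda>w. int (log_point w)) P"
proof (rule inj_onI, rule ccontr)
  fix w w' assume *: "w \<in> P" "w' \<in> P" "int (log_point w) = int (log_point w')" "w \<noteq> w'"
  \<comment> \<open>With equal logarithms, the pair and its reversal both have difference 0.\<close>
  then show False using log_point_sidon[of w w' w' w] by simp
qed

end

definition sidon_mod :: "int \<Rightarrow> int set \<Rightarrow> bool" where
  "sidon_mod v E \<longleftrightarrow> (\<forall>a\<in>E. \<forall>b\<in>E. \<forall>c\<in>E. \<forall>d\<in>E.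
     a \<noteq> b \<longrightarrow> [a - b = c - d] (mod v) \<longrightarrow> a = c \<and> b = d)"

lemma exists_sidon_mod:
  fixes q :: nat
  assumes "primepow q"
  obtains E where "finite E" "card E = q + 1" "sidon_mod (int (q\<^sup>2 + q + 1)) E"
proof -
  obtain p e where pe: "prime p" "e > 0" "q = p ^ e"
    using assms by (auto simp: primepow_def)
  define N where "N = q ^ 3 - 1"
  have q2: "q \<ge> 2" using primepow_gt_Suc_0[OF assms] by simp
  then have q8: "2 ^ 3 \<le> q ^ 3" by (intro power_mono) auto
  then have N: "N > 0" "Suc N = q ^ 3" by (auto simp: N_def)
  \<comment> \<open>\<open>Suc N\<close> is a power of \<open>p\<close>, so its predecessor
    \<open>N\<close> is coprime to \<open>p\<close>.\<close>
  have "p dvd Suc N" using pe unfolding N by (simp add: dvd_power flip: power_mult)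
  then have "coprime N p" using coprime_Suc_right_nat[of N]
    by (meson coprime_divisors dvd_refl)
  from exists_prime_ideal_roots_of_unity[OF pe(1) N(1) this]
  obtain M :: "int poly set" and x where M: "prime_ring_ideal M" "of_nat p \<in> M" "x ^ N - 1 \<in> M"
    "\<And>i. 0 < i \<Longrightarrow> i < N \<Longrightarrow> x ^ i - 1 \<notin> M"
    "\<And>y. y ^ N - 1 \<in> M \<Longrightarrow> \<exists>i<N. y - x ^ i \<in> M" by metis
  interpret M: prime_ring_ideal M by fact
  interpret singer_field M p e q "q\<^sup>2 + q + 1" N x
    by standard (use M pe in \<open>auto simp: M.ideal_cong_def N_def\<close>)
  show ?thesis
  proof (rule that[of "(\<lambda>w. int (log_point w)) ` P"])
    show "finite ((\<lambda>w. int (log_point w)) ` P)" using card_P by simp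
    show "card ((\<lambda>w. int (log_point w)) ` P) = q + 1" using card_P card_image[OF log_point_inj] by simp
    show "sidon_mod (int (q\<^sup>2 + q + 1)) ((\<lambda>w. int (log_point w)) ` P)"
      unfolding sidon_mod_def using log_point_sidon by (auto; blast)
  qed
qed

subsection \<open>Rulers from sets of residues\<close>

text \<open>An added element that does not enlarge the image creates at least two new ordered
  collisions, one in each order; hence the doubled count.\<close>

lemma two_card_le_image_plus_collisions:
  assumes "finite E"
  shows "2 * card E \<le> 2 * card (f ` E) + card {(a, b). a \<in> E \<and> b \<in> E \<and> a \<noteq> b \<and> f a = f b}"
    (is "_ \<le> _ + card (?coll E)")
  using assms
proof (induction E)
  case empty
  then show ?case by simp
next
  case (insert z E)
  have fin: "finite (?coll (insert z E))"
    by (rule finite_subset[of _ "insert z E \<times> insert z E"]) (use insert.hyps in auto)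
  have mono: "?coll E \<subseteq> ?coll (insert z E)" by auto
  show ?case
  proof (cases "f z \<in> f ` E")
    case False
    then have "card (f ` insert z E) = Suc (card (f ` E))" using insert.hyps by simp
    moreover have "card (insert z E) = Suc (card E)" using insert.hyps by simp
    ultimately show ?thesis using insert.IH card_mono[OF fin mono] by linarith
  next
    case True
    then obtain b where b: "b \<in> E" "f z = f b" by auto
    have "z \<noteq> b" using b insert.hyps by auto
    then have "2 + card (?coll E) = card ({(z, b), (b, z)} \<union> ?coll E)"
      using finite_subset[OF mono fin] insert.hyps by (subst card_Un_disjoint) auto
    also have "\<dots> \<le> card (?coll (insert z E))"
      using b insert.hyps by (intro card_mono[OF fin]) auto
    finally have "2 + card (?coll E) \<le> card (?coll (insert z E))" .
    moreover have "card (f ` insert z E) = card (f ` E)" using True by (simp add: insert_absorb)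
    moreover have "card (insert z E) = Suc (card E)" using insert.hyps by simp
    ultimately show ?thesis using insert.IH by linarith
  qed
qed

text \<open>Differences divisible by \<open>m\<close> are exempt because the diagonal pairs alone
  realise 0 as often as there are marks.\<close>

definition golomb_mod :: "nat \<Rightarrow> int \<Rightarrow> int set \<Rightarrow> bool" where
  "golomb_mod g m A \<longleftrightarrow> A \<subseteq> {0..<m} \<and>
     (\<forall>d. \<not> m dvd d \<longrightarrow> card {(a, c). a \<in> A \<and> c \<in> A \<and> [c - a = d] (mod m)} \<le> g)"

lemma card_residue_class:
  fixes m :: int
  assumes "m > 0" "g > 0"
  shows "card {t \<in> {0..<m * int g}. [t = d] (mod m)} = g"
proof -
  have "bij_betw (\<lambda>j. d mod m + m * int j) {..<g} {t \<in> {0..<m * int g}. [t = d] (mod m)}"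
  proof (rule bij_betwI[where g = "\<lambda>t. nat (t div m)"])
    have "d mod m + m * int j < m * int g" if "j < g" for j
    proof -
      have "d mod m + m * int j < m * (int j + 1)" using assms by (simp add: algebra_simps)
      also have "\<dots> \<le> m * int g" using that assms by (intro mult_left_mono) auto
      finally show ?thesis .
    qed
    then show "(\<lambda>j. d mod m + m * int j) \<in> {..<g} \<rightarrow> {t \<in> {0..<m * int g}. [t = d] (mod m)}"
      using assms by (auto simp: cong_def)
    show "(\<lambda>t. nat (t div m)) \<in> {t \<in> {0..<m * int g}. [t = d] (mod m)} \<rightarrow> {..<g}"
    proof safe
      fix t assume t: "t \<in> {0..<m * int g}"
      have "t div m < int g"
      proof (rule ccontr)
        assume "\<not> ?thesis"
        then have "m * int g \<le> m * (t div m)" using assms by (intro mult_left_mono) auto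
        also have "\<dots> \<le> t" using assms pos_mod_sign[of m t] mult_div_mod_eq[of m t] by linarith
        finally show False using t by simp
      qed
      then show "nat (t div m) < g" using assms by auto
    qed
    show "d mod m + m * int (nat (t div m)) = t" if "t \<in> {t \<in> {0..<m * int g}. [t = d] (mod m)}" for t
    proof -
      have "d mod m = t mod m" "t div m \<ge> 0"
        using that assms by (auto simp: cong_def pos_imp_zdiv_nonneg_iff)
      then show ?thesis using mod_mult_div_eq[of t m] by simp
    qed
  qed (use assms in \<open>auto simp: div_pos_pos_trivial\<close>)
  from bij_betw_same_card[OF this] show ?thesis by simp
qed

text \<open>Off the diagonal, differences modulo \<open>m * g\<close> determine the pair. So pairs
  with difference \<open>d\<close> modulo \<open>m\<close> inject into a residue class of size
  \<open>g\<close>; for colliding pairs the residue 0 itself is excluded too, which leaves at most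
  \<open>g - 1\<close> of them.\<close>

lemma sidon_mod_project:
  fixes m :: int
  assumes E: "finite E" "sidon_mod (m * int g) E" and m: "m > 0" and g: "g > 0"
    and n: "n + g div 2 \<le> card E"
  obtains A where "golomb_mod g m A" "card A = n"
proof -
  define V where "V = m * int g"
  have V: "V > 0" "m dvd V" using m g by (auto simp: V_def)
  define \<delta> where "\<delta> = (\<lambda>(a, b). (b - a) mod V)"
  have sidon: "a = c \<and> b = d"
    if "a \<in> E" "b \<in> E" "c \<in> E" "d \<in> E" "a \<noteq> b" "\<delta> (a, b) = \<delta> (c, d)" for a b c d
  proof -
    have "[b - a = d - c] (mod V)" using that(6) by (simp add: \<delta>_def cong_def)
    then have "[a - b = c - d] (mod V)" using cong_minus_minus_iff[of "b - a" "d - c" V] by simp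
    then show ?thesis using E(2) that(1-5) unfolding sidon_mod_def V_def by blast
  qed
  have pairs: "card S \<le> card T" if S: "S \<subseteq> E \<times> E" "\<And>a. (a, a) \<notin> S" and T: "\<delta> ` S \<subseteq> T" "finite T"
    for S T
  proof (rule card_inj_on_le[OF _ T])
    show "inj_on \<delta> S"
    proof (rule inj_onI)
      fix u w assume "u \<in> S" "w \<in> S" "\<delta> u = \<delta> w"
      then show "u = w" using S sidon by (cases u; cases w) blast
    qed
  qed
  have cls: "finite {t \<in> {0..<V}. [t = d] (mod m)}" for d
    by (rule finite_subset[of _ "{0..<V}"]) auto
  have \<delta>_cong: "[\<delta> (a, b) = b - a] (mod m)" for a b
    unfolding \<delta>_def using V(2) by (simp add: cong_def mod_mod_cancel)
  have \<delta>_range: "\<delta> (a, b) \<in> {0..<V}" for a b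
    unfolding \<delta>_def using V(1) by simp
  define f where "f = (\<lambda>a::int. a mod m)"
  let ?coll = "{(a, b). a \<in> E \<and> b \<in> E \<and> a \<noteq> b \<and> f a = f b}"
  have "card ?coll \<le> card ({t \<in> {0..<V}. [t = 0] (mod m)} - {0})"
  proof (rule pairs)
    show "\<delta> ` ?coll \<subseteq> {t \<in> {0..<V}. [t = 0] (mod m)} - {0}"
    proof (rule subsetI, elim imageE)
      fix t u assume t: "t = \<delta> u" and u: "u \<in> ?coll"
      obtain a b where ab: "u = (a, b)" "a \<in> E" "b \<in> E" "a \<noteq> b" "f a = f b" using u by blast
      have "[b - a = 0] (mod m)" using ab(5) by (simp add: f_def cong_iff_dvd_diff mod_eq_dvd_iff dvd_diff_commute)
      then have "[t = 0] (mod m)" using \<delta>_cong cong_trans unfolding t ab by blast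
      moreover have "t \<noteq> 0"
      proof
        assume "t = 0"
        then have "\<delta> (a, b) = \<delta> (a, a)" by (simp add: t ab \<delta>_def)
        then show False using sidon[of a b a a] ab by auto
      qed
      ultimately show "t \<in> {t \<in> {0..<V}. [t = 0] (mod m)} - {0}"
        using \<delta>_range unfolding t ab by auto
    qed
  qed (use cls in auto)
  also have "\<dots> = g - 1"
    using card_residue_class[OF m g, of 0] V by (subst card_Diff_singleton) (simp_all flip: V_def)
  finally have "2 * card E \<le> 2 * card (f ` E) + (g - 1)"
    using two_card_le_image_plus_collisions[OF E(1), of f] by linarith
  \<comment> \<open>Here \<open>2 * (g div 2) >= g - 1\<close> for either parity of
    \<open>g\<close>.\<close>
  then have "n \<le> card (f ` E)" using n g by linarith
  then obtain A where A: "A \<subseteq> f ` E" "card A = n"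
    using obtain_subset_with_card_n[of n "f ` E"] by metis
  have "golomb_mod g m A"
    unfolding golomb_mod_def
  proof (intro conjI allI impI)
    show "A \<subseteq> {0..<m}" using A m by (auto simp: f_def)
  next
    fix d assume d: "\<not> m dvd d"
    \<comment> \<open>Marks are lifted back to \<open>E\<close>, where the Sidon property is
      available; \<open>d\<close> being nonzero modulo \<open>m\<close> keeps the lifted pairs off
      the diagonal.\<close>
    define s where "s = inv_into E f"
    have s: "s y \<in> E" "s y mod m = y" if "y \<in> A" for y
      using that A(1) inv_into_into[of y f E] f_inv_into_f[of y f E] by (auto simp: s_def f_def)
    let ?S = "{(a, c). a \<in> A \<and> c \<in> A \<and> [c - a = d] (mod m)}"
    let ?s = "\<lambda>(a, c). (s a, s c)"
    have "inj_on ?s ?S"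
    proof (rule inj_onI)
      fix u w assume "u \<in> ?S" "w \<in> ?S" "?s u = ?s w"
      then show "u = w" using s(2) by (cases u; cases w) (simp, metis)
    qed
    then have "card ?S = card (?s ` ?S)" by (simp add: card_image)
    also have "\<dots> \<le> card {t \<in> {0..<V}. [t = d] (mod m)}"
    proof (rule pairs)
      show "?s ` ?S \<subseteq> E \<times> E" using s(1) by auto
      show "(a, a) \<notin> ?s ` ?S" for a
      proof
        assume "(a, a) \<in> ?s ` ?S"
        then obtain y z where yz: "y \<in> A" "z \<in> A" "[z - y = d] (mod m)" "s y = s z" by auto
        then have "y = z" using s(2) by metis
        then have "[0 = d] (mod m)" using yz(3) by simp
        then show False using d by (simp add: cong_iff_dvd_diff)
      qed
      show "\<delta> ` ?s ` ?S \<subseteq> {t \<in> {0..<V}. [t = d] (mod m)}"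
      proof (rule subsetI, elim imageE)
        fix t u w assume "t = \<delta> u" "u = ?s w" "w \<in> ?S"
        then obtain y z where yz: "y \<in> A" "z \<in> A" "[z - y = d] (mod m)" "t = \<delta> (s y, s z)" by auto
        have "[s z - s y = z - y] (mod m)"
          using s(2)[OF yz(1)] s(2)[OF yz(2)] by (metis cong_def mod_diff_eq mod_mod_trivial)
        then have "[t = d] (mod m)" using \<delta>_cong yz(3,4) cong_trans by blast
        then show "t \<in> {t \<in> {0..<V}. [t = d] (mod m)}" using \<delta>_range yz(4) by auto
      qed
    qed (rule cls)
    also have "\<dots> = g" using card_residue_class[OF m g] by (simp add: V_def)
    finally show "card ?S \<le> g" .
  qed
  then show ?thesis using that A(2) by blast
qed

section \<open>Gap lengths and cutting the circle\<close>

text \<open>Remove an index \<open>i\<close> of largest value. All \<open>k + 1\<close> values lie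
  in 0..h i and each occurs at most \<open>g\<close> times, so \<open>k < g * (h i + 1)\<close> and
  the removed value is at least \<open>k div g\<close>.\<close>

lemma sum_ge_sum_div:
  fixes h :: "nat \<Rightarrow> nat"
  assumes "finite I" "g > 0" "\<And>y. card {i \<in> I. h i = y} \<le> g"
  shows "(\<Sum>j<card I. j div g) \<le> (\<Sum>i\<in>I. h i)"
  using assms(1,3)
proof (induction "card I" arbitrary: I)
  case 0
  then show ?case by simp
next
  case (Suc k)
  have "h ` I \<noteq> {}" using Suc.hyps(2) by auto
  then have "Max (h ` I) \<in> h ` I" using Suc.prems(1) by (intro Max_in) auto
  then obtain i where i: "i \<in> I" "h i = Max (h ` I)"
    by (metis imageE)
  have max: "h j \<le> h i" if "j \<in> I" for j using that i(2) Suc.prems(1) by simp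
  have "card I \<le> card (\<Union>y\<in>{..h i}. {j \<in> I. h j = y})"
    using max Suc.prems(1) by (intro card_mono) auto
  also have "\<dots> \<le> (\<Sum>y\<in>{..h i}. card {j \<in> I. h j = y})"
    by (rule card_UN_le) simp
  also have "\<dots> \<le> (\<Sum>y\<in>{..h i}. g)" by (intro sum_mono Suc.prems)
  finally have "k < g * Suc (h i)" using Suc.hyps(2) by (simp add: mult.commute)
  then have k: "k div g \<le> h i"
    by (metis less_Suc_eq_le less_mult_imp_div_less mult.commute)
  have cardk: "card (I - {i}) = k" using Suc.hyps(2) i Suc.prems(1) by simp
  have "(\<Sum>j<card (I - {i}). j div g) \<le> (\<Sum>i\<in>I - {i}. h i)"
  proof (rule Suc.hyps(1))
    fix y
    have "card {j \<in> I - {i}. h j = y} \<le> card {j \<in> I. h j = y}"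
      using Suc.prems(1) by (intro card_mono) auto
    then show "card {j \<in> I - {i}. h j = y} \<le> g" using Suc.prems(2) by (rule order_trans)
  qed (use cardk Suc.prems in auto)
  moreover have "(\<Sum>j<card I. j div g) = (\<Sum>j<k. j div g) + k div g"
    unfolding Suc.hyps(2)[symmetric] by simp
  moreover have "(\<Sum>i\<in>I. h i) = h i + (\<Sum>i\<in>I - {i}. h i)"
    using i(1) Suc.prems(1) by (rule sum.remove[rotated])
  ultimately show ?case using k unfolding cardk by linarith
qed

text \<open>The quotient is constant on blocks of length \<open>g\<close>; the last, incomplete
  block has \<open>n mod g\<close> terms. Doubling avoids a division, and integers keep the factor
  \<open>n div g - 1\<close> correct for \<open>n < g\<close>.\<close>

lemma sum_div_closed_form:
  assumes "(g::nat) > 0"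
  shows "2 * (\<Sum>j<n. int (j div g)) = int g * int (n div g) * (int (n div g) - 1)
    + 2 * int (n mod g) * int (n div g)"
proof (induction n)
  case (Suc n)
  show ?case
  proof (cases "Suc (n mod g) = g")
    case True
    then have "Suc n div g = Suc (n div g)" "Suc n mod g = 0" and r: "int (n mod g) = int g - 1"
      by (auto simp: div_Suc mod_Suc)
    then show ?thesis using Suc[unfolded r]
      by (simp only: sum.lessThan_Suc of_nat_Suc of_nat_0 of_nat_1) (simp add: algebra_simps)
  next
    case False
    then have "Suc n div g = n div g" "Suc n mod g = Suc (n mod g)"
      by (simp_all add: div_Suc mod_Suc)
    then show ?thesis using Suc
      by (simp only: sum.lessThan_Suc of_nat_Suc) (simp add: algebra_simps)
  qed
qed simp

text \<open>The marks are continued periodically to \<open>s\<close>, so that a cut ruler is a window of \<open>n\<close> consecutive values.\<close>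
lemma golomb_mod_cut:
  assumes A: "golomb_mod g m A" and n: "card A = n" "n > 0" and m: "m > 0" and g: "g > 0"
  obtains S G where "golomb_ruler g S" "card S = n" "diameter S = m - G" "0 < G" "G \<le> m"
    "m + (\<Sum>j<n. int (j div g)) \<le> int n * G"
proof -
  have A_sub: "A \<subseteq> {0..<m}"
    and A_diff: "\<And>d. \<not> m dvd d \<Longrightarrow> card {(a, c). a \<in> A \<and> c \<in> A \<and> [c - a = d] (mod m)} \<le> g"
    using A by (auto simp: golomb_mod_def)
  have finA: "finite A" using finite_subset[OF A_sub] by simp
  define l where "l = sorted_list_of_set A"
  have l: "length l = n" "set l = A" "distinct l"
    and l_less: "\<And>i j. i < j \<Longrightarrow> j < n \<Longrightarrow> l ! i < l ! j"
    using n finA sorted_wrt_nth_less[OF strict_sorted_list_of_set[of A]] by (auto simp: l_def)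
  have l_A: "l ! i \<in> A" if "i < n" for i using that l by (metis nth_mem)
  have l_range: "0 \<le> l ! i" "l ! i < m" if "i < n" for i
    using l_A[OF that] A_sub by auto
  define s where "s i = l ! (i mod n) + m * int (i div n)" for i
  have s_mod: "s i mod m = l ! (i mod n)" for i
    using l_range[of "i mod n"] n(2) by (simp add: s_def)
  have s_period: "s (i + n) = s i + m" for i
    using n(2) by (simp add: s_def algebra_simps)
  have s_step: "s i < s (Suc i)" for i
  proof (cases "Suc (i mod n) = n")
    case True
    then have "Suc i div n = Suc (i div n)" "Suc i mod n = 0" by (auto simp: div_Suc mod_Suc)
    then show ?thesis using l_range(2)[of "i mod n"] l_range(1)[of 0] n(2)
      by (simp add: s_def algebra_simps)
  next
    case False
    then have "Suc i div n = i div n" "Suc i mod n = Suc (i mod n)" by (auto simp: div_Suc mod_Suc)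
    moreover have "Suc (i mod n) < n" using False n(2) by (meson Suc_lessI mod_less_divisor)
    ultimately show ?thesis using l_less[of "i mod n" "Suc (i mod n)"] by (simp add: s_def)
  qed
  have s_mono: "strict_mono s" using s_step by (simp add: strict_mono_Suc_iff)
  define \<gamma> where "\<gamma> i = s (Suc i) - s i" for i
  have \<gamma>_pos: "\<gamma> i > 0" for i using s_step by (simp add: \<gamma>_def)
  have \<gamma>_sum: "(\<Sum>i<n. \<gamma> i) = m"
    using s_period[of 0] unfolding \<gamma>_def by (subst sum_lessThan_telescope) simp
  define G where "G = Max (\<gamma> ` {..<n})"
  have G_ge: "\<gamma> i \<le> G" if "i < n" for i using that unfolding G_def by (intro Max_ge) auto
  have "G \<in> \<gamma> ` {..<n}" unfolding G_def using n(2) by (intro Max_in) auto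
  then obtain k where k: "k < n" "G = \<gamma> k" by auto
  have G_le: "G \<le> m"
    using \<gamma>_sum k member_le_sum[of k "{..<n}" \<gamma>] \<gamma>_pos by (simp add: less_imp_le)
  \<comment> \<open>The residues of the two end points of a gap determine its index, so equal gaps
    give distinct pairs with the same difference.\<close>
  have \<gamma>_mult: "card {i \<in> {..<n}. \<gamma> i = y} \<le> g" for y
  proof (cases "m dvd y")
    case False
    let ?f = "\<lambda>i. (s i mod m, s (Suc i) mod m)"
    have "inj_on ?f {i \<in> {..<n}. \<gamma> i = y}"
    proof (rule inj_onI)
      fix i j assume "i \<in> {i \<in> {..<n}. \<gamma> i = y}" "j \<in> {i \<in> {..<n}. \<gamma> i = y}" "?f i = ?f j"
      then show "i = j" using l by (auto simp: s_mod nth_eq_iff_index_eq)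
    qed
    moreover have "?f ` {i \<in> {..<n}. \<gamma> i = y} \<subseteq> {(a, c). a \<in> A \<and> c \<in> A \<and> [c - a = y] (mod m)}"
    proof -
      have "[s (Suc i) mod m - s i mod m = \<gamma> i] (mod m)" for i
        by (simp add: \<gamma>_def cong_def mod_diff_eq)
      moreover have "s i mod m \<in> A" for i using l_A n(2) by (simp add: s_mod)
      ultimately show ?thesis by auto
    qed
    moreover have "finite {(a, c). a \<in> A \<and> c \<in> A \<and> [c - a = y] (mod m)}"
      by (rule finite_subset[of _ "A \<times> A"]) (use finA in auto)
    ultimately show ?thesis by (rule order_trans[OF card_inj_on_le A_diff[OF False]])
  next
    case True
    \<comment> \<open>\<open>golomb_mod\<close> says nothing here, but the gaps are positive with
      sum \<open>m\<close>, so at most one of them can be a multiple of \<open>m\<close>.\<close>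
    have "i = j" if ij: "i < n" "j < n" "\<gamma> i = y" "\<gamma> j = y" for i j
    proof (rule ccontr)
      assume "i \<noteq> j"
      have "m \<le> y" using True \<gamma>_pos[of i] ij by (intro zdvd_imp_le) auto
      have "2 * y = (\<Sum>k\<in>{i, j}. \<gamma> k)" using \<open>i \<noteq> j\<close> ij by simp
      also have "\<dots> \<le> (\<Sum>k<n. \<gamma> k)"
        using ij \<gamma>_pos by (intro sum_mono2) (auto simp: less_imp_le)
      finally show False using \<open>m \<le> y\<close> m \<gamma>_sum by simp
    qed
    then have "card {i \<in> {..<n}. \<gamma> i = y} \<le> 1"
      by (subst card_le_Suc0_iff_eq[unfolded One_nat_def[symmetric]]) auto
    then show ?thesis using g by linarith
  qed
  \<comment> \<open>The deficits from the largest gap sum to \<open>n * G - m\<close> and inherit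
    the multiplicity bound \<open>g\<close>, so \<open>sum_ge_sum_div\<close> bounds this sum from
    below.\<close>
  define h where "h i = nat (G - \<gamma> i)" for i
  have "card {i \<in> {..<n}. h i = y} \<le> g" for y
  proof -
    have "{i \<in> {..<n}. h i = y} \<subseteq> {i \<in> {..<n}. \<gamma> i = G - int y}"
      using G_ge by (auto simp: h_def)
    then have "card {i \<in> {..<n}. h i = y} \<le> card {i \<in> {..<n}. \<gamma> i = G - int y}"
      by (intro card_mono) auto
    then show ?thesis using \<gamma>_mult[of "G - int y"] by (rule order_trans)
  qed
  from sum_ge_sum_div[OF _ g this]
  have "(\<Sum>j<n. j div g) \<le> (\<Sum>i<n. h i)" by simp
  then have "(\<Sum>j<n. int (j div g)) \<le> (\<Sum>i<n. int (h i))" by (simp flip: of_nat_sum)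
  also have "\<dots> = (\<Sum>i<n. G - \<gamma> i)" using G_ge by (intro sum.cong) (auto simp: h_def)
  also have "\<dots> = int n * G - m" by (simp add: sum_subtractf \<gamma>_sum)
  finally have bound: "m + (\<Sum>j<n. int (j div g)) \<le> int n * G" by simp
  \<comment> \<open>The window opens right after the largest gap and ends at
    \<open>s (k + n) = s k + m\<close>, so its length is \<open>m - G\<close>.\<close>
  define S where "S = s ` {Suc k..k + n}"
  have finS: "finite S" by (simp add: S_def)
  have cardS: "card S = n"
    unfolding S_def using s_mono by (subst card_image) (auto intro: strict_mono_imp_inj_on)
  have S_bounds: "s (Suc k) \<le> y \<and> y \<le> s k + m" if "y \<in> S" for y
    using that s_mono unfolding S_def by (auto simp: s_period[symmetric] strict_mono_less_eq)
  have S_ends: "s (Suc k) \<in> S" "s k + m \<in> S"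
    using n(2) unfolding S_def by (auto simp: s_period[symmetric])
  have "Max S = s k + m" "Min S = s (Suc k)"
    using S_bounds S_ends finS by (auto intro: Max_eqI Min_eqI)
  then have diam: "diameter S = m - G" by (simp add: diameter_def k \<gamma>_def)
  \<comment> \<open>The window is shorter than \<open>m\<close>, so reduction modulo
    \<open>m\<close> is injective on it and only differences below \<open>m\<close> occur.\<close>
  have S_close: "\<bar>y - z\<bar> < m" if "y \<in> S" "z \<in> S" for y z
    using S_bounds[OF that(1)] S_bounds[OF that(2)] s_step[of k] by linarith
  have S_inj: "y = z" if "y \<in> S" "z \<in> S" "y mod m = z mod m" for y z
  proof (rule ccontr)
    assume "y \<noteq> z"
    moreover have "m dvd y - z" using that(3) by (simp add: mod_eq_dvd_iff)
    ultimately have "m \<le> \<bar>y - z\<bar>" by (intro zdvd_imp_le) auto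
    then show False using S_close[OF that(1,2)] by simp
  qed
  have S_A: "y mod m \<in> A" if "y \<in> S" for y
    using that l_A n(2) by (auto simp: S_def s_mod)
  have "golomb_ruler g S"
    unfolding golomb_ruler_def
  proof (intro conjI allI impI finS)
    fix d :: int assume d: "d > 0"
    let ?D = "{(a, c). a \<in> S \<and> c \<in> S \<and> c - a = d}"
    show "card ?D \<le> g"
    proof (cases "d < m")
      case False
      then have "?D = {}" using S_close by fastforce
      then show ?thesis by (metis card.empty le0)
    next
      case True
      then have nd: "\<not> m dvd d" using d by (simp add: zdvd_not_zless)
      let ?f = "\<lambda>(a, c). (a mod m, c mod m)"
      have "inj_on ?f ?D" by (rule inj_onI) (auto intro: S_inj)
      moreover have "?f ` ?D \<subseteq> {(a, c). a \<in> A \<and> c \<in> A \<and> [c - a = d] (mod m)}"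
        using S_A by (auto simp: cong_def mod_diff_eq)
      moreover have "finite {(a, c). a \<in> A \<and> c \<in> A \<and> [c - a = d] (mod m)}"
        by (rule finite_subset[of _ "A \<times> A"]) (use finA in auto)
      ultimately show ?thesis by (rule order_trans[OF card_inj_on_le A_diff[OF nd]])
    qed
  qed
  then show ?thesis using that[of S G] cardS diam bound G_le \<gamma>_pos k by simp
qed

section \<open>The estimate for the minimal diameter\<close>

theorem theorem7:
  fixes q g n :: nat and a r :: int
  assumes "primepow q"
    and "g > 0" and "n > 0"
    and "g dvd q\<^sup>2 + q + 1"
    and "int n \<le> int q + 1 - \<lfloor>real g / 2\<rfloor>"
    and "int n = a * int g + r"
    and "0 \<le> r" and "r < int g"
  shows "real (min_golomb_diameter g n) \<le>
    real (q\<^sup>2 + q + 1) / real g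
    - real_of_int \<lceil>(real (q\<^sup>2 + q + 1) / real g
        + real g * real_of_int a * (real_of_int a - 1) / 2
        + real_of_int r * real_of_int a) / real n\<rceil>"
proof -
  obtain m where m: "q\<^sup>2 + q + 1 = g * m" using assms(4) by (elim dvdE)
  have m_pos: "m > 0" using m by (cases m) auto
  have m_div: "real (q\<^sup>2 + q + 1) / real g = real m" using m assms(2) by simp
  obtain E where E: "finite E" "card E = q + 1" "sidon_mod (int (q\<^sup>2 + q + 1)) E"
    using exists_sidon_mod[OF assms(1)] .
  have "\<lfloor>real g / 2\<rfloor> = int (g div 2)"
    using floor_divide_of_nat_eq[of g 2] by simp
  then have n_le: "n + g div 2 \<le> q + 1" using assms(5) by linarith
  have "sidon_mod (int m * int g) E" using E(3) m by (metis of_nat_mult mult.commute)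
  then obtain A where A: "golomb_mod g (int m) A" "card A = n"
    using sidon_mod_project[of E "int m" g n] E m_pos assms(2) n_le by auto
  obtain S G where S: "golomb_ruler g S" "card S = n" "diameter S = int m - G" "0 < G" "G \<le> int m"
    and G: "int m + (\<Sum>j<n. int (j div g)) \<le> int n * G"
    using golomb_mod_cut[OF A assms(3) _ assms(2)] m_pos by auto
  have "min_golomb_diameter g n \<le> nat (int m - G)"
    unfolding min_golomb_diameter_def by (rule Least_le) (use S in auto)
  then have upper: "real (min_golomb_diameter g n) \<le> real m - real_of_int G"
    using S by linarith
  \<comment> \<open>Uniqueness of division with remainder identifies \<open>a\<close> and
    \<open>r\<close>.\<close>
  have ar: "int (n div g) = a" "int (n mod g) = r"
    using assms(6,7,8) by (simp_all add: zdiv_int zmod_int)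
  define T where "T = (\<Sum>j<n. int (j div g))"
  have "2 * T = int g * a * (a - 1) + 2 * r * a"
    using sum_div_closed_form[OF assms(2), of n] by (simp only: ar T_def)
  then have "real_of_int (2 * T) = real_of_int (int g * a * (a - 1) + 2 * r * a)" by simp
  then have T: "real_of_int T = real g * real_of_int a * (real_of_int a - 1) / 2
      + real_of_int r * real_of_int a"
    by (simp add: field_simps)
  have "real_of_int (int m + T) \<le> real_of_int (int n * G)"
    using G unfolding T_def by (simp only: of_int_le_iff)
  then have "(real m + real_of_int T) / real n \<le> real_of_int G"
    using assms(3) by (simp add: field_simps)
  \<comment> \<open>\<open>G\<close> is an integer, so the lower bound for it may be rounded
    up.\<close>
  then have "\<lceil>(real m + real_of_int T) / real n\<rceil> \<le> G" by (simp add: ceiling_le_iff)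
  then show ?thesis using upper unfolding m_div T by (simp add: add.assoc)
qed

end
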